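(* Let $\phi$ be a right continuing code with a retract from a shift space $X$ onto a shift space $Y$. Then there exists a topological conjugacy $\psi$ from $X$ to a shift space $\bar X$ such that $\phi\circ\psi^{-1}:\bar X\to Y$ is a right continuing 1-block code with retract $0$.
   Context: A shift space over a finite alphabet $A$ is a closed shift-invariant subset of $A^{\mathbb{Z}}$. A block code between shift spaces is a continuous shift-commuting map; it is a 1-block code if $(\phi(x))_0$ is determined by $x_0$. A topological conjugacy is a bijective block code. Two points $x,x'$ are left asymptotic if there is $n\in\mathbb{Z}$ with $x_i=x'_i$ for all $i\le n$. A block code $\phi$ from $X$ onto $Y$ is right continuing if for each $x\in X$ and $y\in Y$ such that $\phi(x)$ is left asymptotic to $y$, there is at least one $\bar x\in X$ that is left asymptotic to $x$ with $\phi(\bar x)=y$. A right continuing code $\phi$ from $X$ onto $Y$ has a retract $n\in\mathbb{N}$ (where $0\in\mathbb{N}$) if for all $x\in X$ and $y\in Y$ with $(\phi x)_i=y_i$ for all $i\le 0$, there is $\bar x\in X$ with $\phi\bar x=y$ and $\bar x_i=x_i$ for all $i\le -n$. *)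

theory Defs
  imports "HOL-Analysis.Analysis"
begin

text \<open>Alphabets are explicit finite sets, so one carrier type serves shift spaces over different
  alphabets. A map between shift spaces is a HOL function of which only the values on its domain
  matter.\<close>

definition full_shift :: "'a set \<Rightarrow> (int \<Rightarrow> 'a) topology" where
  "full_shift A = product_topology (\<lambda>_. discrete_topology A) UNIV"

definition shift_map :: "(int \<Rightarrow> 'a) \<Rightarrow> (int \<Rightarrow> 'a)" where
  "shift_map x = (\<lambda>i. x (i + 1))"

definition shift_space :: "'a set \<Rightarrow> (int \<Rightarrow> 'a) set \<Rightarrow> bool" where
  "shift_space A X \<longleftrightarrow> finite A \<and> closedin (full_shift A) X \<and> shift_map ` X = X"

definition block_code ::
  "'a set \<Rightarrow> (int \<Rightarrow> 'a) set \<Rightarrow> 'b set \<Rightarrow> (int \<Rightarrow> 'b) set \<Rightarrow> ((int \<Rightarrow> 'a) \<Rightarrow> (int \<Rightarrow> 'b)) \<Rightarrow> bool" where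
  "block_code A X B Y \<phi> \<longleftrightarrow>
     continuous_map (subtopology (full_shift A) X) (subtopology (full_shift B) Y) \<phi> \<and>
     (\<forall>x\<in>X. \<phi> (shift_map x) = shift_map (\<phi> x))"

definition one_block_code ::
  "'a set \<Rightarrow> (int \<Rightarrow> 'a) set \<Rightarrow> 'b set \<Rightarrow> (int \<Rightarrow> 'b) set \<Rightarrow> ((int \<Rightarrow> 'a) \<Rightarrow> (int \<Rightarrow> 'b)) \<Rightarrow> bool" where
  "one_block_code A X B Y \<phi> \<longleftrightarrow>
     block_code A X B Y \<phi> \<and> (\<forall>x\<in>X. \<forall>x'\<in>X. x 0 = x' 0 \<longrightarrow> \<phi> x 0 = \<phi> x' 0)"

definition topological_conjugacy ::
  "'a set \<Rightarrow> (int \<Rightarrow> 'a) set \<Rightarrow> 'b set \<Rightarrow> (int \<Rightarrow> 'b) set \<Rightarrow> ((int \<Rightarrow> 'a) \<Rightarrow> (int \<Rightarrow> 'b)) \<Rightarrow> bool" where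
  "topological_conjugacy A X B Y \<psi> \<longleftrightarrow> block_code A X B Y \<psi> \<and> bij_betw \<psi> X Y"

definition left_asymptotic :: "(int \<Rightarrow> 'a) \<Rightarrow> (int \<Rightarrow> 'a) \<Rightarrow> bool" where
  "left_asymptotic x x' \<longleftrightarrow> (\<exists>n. \<forall>i\<le>n. x i = x' i)"

definition right_continuing ::
  "'a set \<Rightarrow> (int \<Rightarrow> 'a) set \<Rightarrow> 'b set \<Rightarrow> (int \<Rightarrow> 'b) set \<Rightarrow> ((int \<Rightarrow> 'a) \<Rightarrow> (int \<Rightarrow> 'b)) \<Rightarrow> bool" where
  "right_continuing A X B Y \<phi> \<longleftrightarrow>
     block_code A X B Y \<phi> \<and> \<phi> ` X = Y \<and>
     (\<forall>x\<in>X. \<forall>y\<in>Y. left_asymptotic (\<phi> x) y \<longrightarrow>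
        (\<exists>z\<in>X. left_asymptotic z x \<and> \<phi> z = y))"

definition has_retract ::
  "(int \<Rightarrow> 'a) set \<Rightarrow> (int \<Rightarrow> 'b) set \<Rightarrow> ((int \<Rightarrow> 'a) \<Rightarrow> (int \<Rightarrow> 'b)) \<Rightarrow> nat \<Rightarrow> bool" where
  "has_retract X Y \<phi> n \<longleftrightarrow>
     (\<forall>x\<in>X. \<forall>y\<in>Y. (\<forall>i\<le>0. \<phi> x i = y i) \<longrightarrow>
        (\<exists>z\<in>X. \<phi> z = y \<and> (\<forall>i\<le>- int n. z i = x i)))"

end

theory Submission
  imports Defs
begin

text \<open>
  Let \<open>n\<close> be a retract of \<open>\<phi>\<close>. Recode a point \<open>x\<close> by writing at each coordinate \<open>i\<close> the pair
  \<open>(x (i - n), \<phi> x i)\<close>. The first components recover \<open>x\<close>, so the recoding \<open>\<psi>\<close> is a conjugacy onto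
  its image, which is closed because \<open>X\<close> is compact and the full shift is Hausdorff. The second
  components spell out \<open>\<phi> x\<close>, so \<open>\<phi> \<circ> \<psi>\<^sup>-\<^sup>1\<close> merely reads off a component of each symbol and is a
  1-block code.

  The delay by \<open>n\<close> is what brings the retract down to \<open>0\<close>. If \<open>\<phi> x\<close> and \<open>y\<close> agree on the coordinates
  \<open>i \<le> 0\<close>, the retract supplies a preimage \<open>z\<close> of \<open>y\<close> that is only known to agree with \<open>x\<close> on
  \<open>i \<le> - n\<close>. But \<open>\<psi> x i\<close> for \<open>i \<le> 0\<close> looks at \<open>x\<close> only at coordinates \<open>\<le> - n\<close>, and its other
  component is \<open>\<phi> x i = y i\<close>; hence \<open>\<psi> z\<close> and \<open>\<psi> x\<close> agree on all \<open>i \<le> 0\<close>.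
  Recording the value of \<open>\<phi>\<close>, rather than a window of \<open>x\<close> that determines it, is essential here:
  \<open>\<phi> x 0\<close> may depend on coordinates of \<open>x\<close> far to the right of \<open>- n\<close>, where \<open>z\<close> and \<open>x\<close> may differ.

  The pairs are numbered by an injection \<open>e\<close> of the finite set of pairs of symbols into the naturals.
\<close>

lemma topspace_full_shift: "topspace (full_shift A) = {x. \<forall>i. x i \<in> A}"
  by (auto simp: full_shift_def PiE_def Pi_def)

lemma compact_space_full_shift: "finite A \<Longrightarrow> compact_space (full_shift A)"
  by (simp add: full_shift_def compact_space_product_topology compact_space_discrete_topology)

lemma Hausdorff_space_full_shift: "Hausdorff_space (full_shift A)"
  by (simp add: full_shift_def Hausdorff_space_product_topology)

lemma continuous_map_into_full_shift:
  "continuous_map T (full_shift A) g \<longleftrightarrow>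
     (\<forall>i. continuous_map T (discrete_topology A) (\<lambda>x. g x i))"
  by (simp add: full_shift_def continuous_map_componentwise_UNIV)

lemma continuous_map_coordinate:
  "continuous_map (subtopology (full_shift A) X) (discrete_topology A) (\<lambda>x. x i)"
  using continuous_map_into_full_shift[of "full_shift A" A id]
  by (auto intro: continuous_map_from_subtopology)

lemma shift_space_subset: "shift_space A X \<Longrightarrow> X \<subseteq> {x. \<forall>i. x i \<in> A}"
  using closedin_subset topspace_full_shift unfolding shift_space_def by blast

text \<open>Closedness is the only issue: the image is compact, and compact sets are closed in the
  Hausdorff space \<open>full_shift C\<close>.\<close>

lemma shift_space_image:
  assumes X: "shift_space A X" and C: "finite C"
    and cont: "continuous_map (subtopology (full_shift A) X) (full_shift C) \<psi>"
    and shift: "\<And>x. x \<in> X \<Longrightarrow> \<psi> (shift_map x) = shift_map (\<psi> x)"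
  shows "shift_space C (\<psi> ` X)"
proof -
  have "compactin (full_shift A) X"
    using X by (auto simp: shift_space_def intro: closedin_compact_space compact_space_full_shift)
  then have "compactin (full_shift C) (\<psi> ` X)"
    by (simp add: image_compactin[OF _ cont] compactin_subtopology)
  then have "closedin (full_shift C) (\<psi> ` X)"
    using Hausdorff_space_full_shift compactin_imp_closedin by blast
  moreover have "shift_map ` \<psi> ` X = \<psi> ` shift_map ` X"
    by (auto simp: image_image shift intro!: image_cong)
  ultimately show ?thesis
    using X C by (simp add: shift_space_def)
qed

definition delayed_graph ::
  "('a \<times> 'b \<Rightarrow> 'c) \<Rightarrow> nat \<Rightarrow> ((int \<Rightarrow> 'a) \<Rightarrow> (int \<Rightarrow> 'b)) \<Rightarrow> (int \<Rightarrow> 'a) \<Rightarrow> (int \<Rightarrow> 'c)" where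
  "delayed_graph e n \<phi> x = (\<lambda>i. e (x (i - int n), \<phi> x i))"

lemma delayed_graph_cong:
  assumes "\<And>i. i \<le> k - int n \<Longrightarrow> x i = x' i" and "\<And>i. i \<le> k \<Longrightarrow> \<phi> x i = \<phi> x' i" and "i \<le> k"
  shows "delayed_graph e n \<phi> x i = delayed_graph e n \<phi> x' i"
  using assms by (simp add: delayed_graph_def)

context
  fixes A :: "'a set" and B :: "'b set" and X Y \<phi> and n :: nat and e :: "'a \<times> 'b \<Rightarrow> 'c"
  assumes X: "shift_space A X" and Y: "shift_space B Y"
    and code: "block_code A X B Y \<phi>" and onto: "\<phi> ` X = Y"
    and inj_e: "inj_on e (A \<times> B)"
begin

lemma delayed_graph_eqD:
  assumes "x \<in> X" "x' \<in> X" "delayed_graph e n \<phi> x i = delayed_graph e n \<phi> x' i"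
  shows "x (i - int n) = x' (i - int n)" and "\<phi> x i = \<phi> x' i"
proof -
  have "x j \<in> A" "\<phi> x j \<in> B" "x' j \<in> A" "\<phi> x' j \<in> B" for j
    using assms(1,2) shift_space_subset[OF X] shift_space_subset[OF Y] onto by blast+
  then show "x (i - int n) = x' (i - int n)" and "\<phi> x i = \<phi> x' i"
    using assms(3) inj_e by (auto simp: delayed_graph_def dest: inj_onD)
qed

lemma inj_on_delayed_graph: "inj_on (delayed_graph e n \<phi>) X"
proof (rule inj_onI, rule ext)
  fix x x' i assume "x \<in> X" "x' \<in> X" "delayed_graph e n \<phi> x = delayed_graph e n \<phi> x'"
  then show "x i = x' i"
    using delayed_graph_eqD(1)[of x x' "i + int n"] by simp
qed

lemma continuous_map_delayed_graph:
  "continuous_map (subtopology (full_shift A) X) (full_shift (e ` (A \<times> B))) (delayed_graph e n \<phi>)"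
  unfolding continuous_map_into_full_shift
proof
  fix i
  let ?T = "subtopology (full_shift A) X"
  have "continuous_map ?T (full_shift B) \<phi>"
    using code by (auto simp: block_code_def continuous_map_in_subtopology)
  then have "continuous_map ?T (prod_topology (discrete_topology A) (discrete_topology B))
      (\<lambda>x. (x (i - int n), \<phi> x i))"
    by (simp add: continuous_map_pairedI continuous_map_coordinate continuous_map_into_full_shift)
  then have "continuous_map ?T (discrete_topology (A \<times> B)) (\<lambda>x. (x (i - int n), \<phi> x i))"
    by (simp add: prod_topology_discrete_topology)
  moreover have "continuous_map (discrete_topology (A \<times> B)) (discrete_topology (e ` (A \<times> B))) e"
    by auto
  ultimately have "continuous_map ?T (discrete_topology (e ` (A \<times> B)))
      (e \<circ> (\<lambda>x. (x (i - int n), \<phi> x i)))"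
    by (rule continuous_map_compose)
  then show "continuous_map ?T (discrete_topology (e ` (A \<times> B)))
      (\<lambda>x. delayed_graph e n \<phi> x i)"
    by (simp only: delayed_graph_def o_def)
qed

lemma delayed_graph_shift:
  "x \<in> X \<Longrightarrow> delayed_graph e n \<phi> (shift_map x) = shift_map (delayed_graph e n \<phi> x)"
  using code by (auto simp: block_code_def delayed_graph_def shift_map_def algebra_simps)

lemma shift_space_delayed_graph: "shift_space (e ` (A \<times> B)) (delayed_graph e n \<phi> ` X)"
proof (rule shift_space_image[OF X _ continuous_map_delayed_graph delayed_graph_shift])
  show "finite (e ` (A \<times> B))"
    using X Y by (simp add: shift_space_def)
qed

lemma topological_conjugacy_delayed_graph:
  "topological_conjugacy A X (e ` (A \<times> B)) (delayed_graph e n \<phi> ` X) (delayed_graph e n \<phi>)"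
  unfolding topological_conjugacy_def block_code_def
  using continuous_map_delayed_graph inj_on_delayed_graph delayed_graph_shift
  by (auto simp: bij_betw_def continuous_map_in_subtopology)

abbreviation "decoded \<equiv> \<phi> \<circ> inv_into X (delayed_graph e n \<phi>)"

lemma decoded_delayed_graph: "x \<in> X \<Longrightarrow> decoded (delayed_graph e n \<phi> x) = \<phi> x"
  using inj_on_delayed_graph by (simp add: inv_into_f_f)

text \<open>Each coordinate of the decoded point is a function of the symbol at the same place. This gives
  the 1-block property and also continuity, since functions on a discrete alphabet are continuous.\<close>

lemma one_block_code_decoded:
  "one_block_code (e ` (A \<times> B)) (delayed_graph e n \<phi> ` X) B Y decoded"
proof -
  let ?C = "e ` (A \<times> B)" and ?Z = "delayed_graph e n \<phi> ` X"
  let ?read = "\<lambda>c. snd (inv_into (A \<times> B) e c)"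
  have read: "decoded z i = ?read (z i)" if z: "z \<in> ?Z" for z i
  proof -
    obtain x where x: "x \<in> X" "z = delayed_graph e n \<phi> x"
      using z by blast
    then have "(x (i - int n), \<phi> x i) \<in> A \<times> B"
      using shift_space_subset[OF X] shift_space_subset[OF Y] onto by blast
    then have "?read (z i) = \<phi> x i"
      by (simp add: x(2) delayed_graph_def inv_into_f_f[OF inj_e])
    then show ?thesis
      using x decoded_delayed_graph by simp
  qed
  have "continuous_map (subtopology (full_shift ?C) ?Z) (discrete_topology B) (\<lambda>z. decoded z i)"
    for i
  proof (rule continuous_map_eq)
    have "?read \<in> ?C \<rightarrow> B"
      using inj_e by auto
    then have "continuous_map (discrete_topology ?C) (discrete_topology B) ?read"
      by simp
    from continuous_map_compose[OF continuous_map_coordinate this]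
    show "continuous_map (subtopology (full_shift ?C) ?Z) (discrete_topology B)
        (\<lambda>z. ?read (z i))"
      by (simp only: o_def)
  qed (simp add: read[unfolded o_def])
  then have "continuous_map (subtopology (full_shift ?C) ?Z) (full_shift B) decoded"
    by (simp add: continuous_map_into_full_shift)
  moreover have "decoded z \<in> Y" if "z \<in> ?Z" for z
    using that decoded_delayed_graph onto by auto
  moreover have "decoded (shift_map z) = shift_map (decoded z)" if z: "z \<in> ?Z" for z
  proof -
    have "shift_map z \<in> ?Z"
      using z shift_space_delayed_graph unfolding shift_space_def by blast
    then show ?thesis
      using z by (auto simp: fun_eq_iff read shift_map_def simp del: o_apply)
  qed
  ultimately have "block_code ?C ?Z B Y decoded"
    unfolding block_code_def by (auto simp: continuous_map_in_subtopology simp del: o_apply)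
  then show ?thesis
    unfolding one_block_code_def using read by simp
qed

text \<open>A preimage \<open>z\<close> of \<open>y\<close> left asymptotic to \<open>x\<close> has a recoding left asymptotic to that of \<open>x\<close>: on the
  far left the first components agree because \<open>z\<close> and \<open>x\<close> do, the second because \<open>y\<close> and \<open>\<phi> x\<close> do.\<close>

lemma right_continuing_decoded:
  assumes "right_continuing A X B Y \<phi>"
  shows "right_continuing (e ` (A \<times> B)) (delayed_graph e n \<phi> ` X) B Y decoded"
proof -
  have "\<exists>w \<in> delayed_graph e n \<phi> ` X. left_asymptotic w (delayed_graph e n \<phi> x) \<and> decoded w = y"
    if x: "x \<in> X" and y: "y \<in> Y" and asym: "left_asymptotic (\<phi> x) y" for x y
  proof -
    obtain z where z: "z \<in> X" "left_asymptotic z x" "\<phi> z = y"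
      using assms x y asym unfolding right_continuing_def by blast
    obtain k l where "\<And>i. i \<le> k \<Longrightarrow> z i = x i" and "\<And>i. i \<le> l \<Longrightarrow> \<phi> x i = y i"
      using z(2) asym unfolding left_asymptotic_def by blast
    then have "\<forall>i \<le> min k l. delayed_graph e n \<phi> z i = delayed_graph e n \<phi> x i"
      using z(3) by (auto intro!: delayed_graph_cong[where k = "min k l"])
    then show ?thesis
      using z decoded_delayed_graph unfolding left_asymptotic_def by blast
  qed
  moreover have "decoded ` delayed_graph e n \<phi> ` X = Y"
    using decoded_delayed_graph onto by (simp add: image_image)
  moreover have "block_code (e ` (A \<times> B)) (delayed_graph e n \<phi> ` X) B Y decoded"
    using one_block_code_decoded unfolding one_block_code_def by blast
  ultimately show ?thesis
    unfolding right_continuing_def using decoded_delayed_graph by (auto simp del: o_apply)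
qed

text \<open>The delay is matched to the retract: the symbols at \<open>i \<le> 0\<close> see a point of \<open>X\<close> exactly on the
  half-line \<open>i \<le> - n\<close> that the retract leaves unchanged.\<close>

lemma has_retract_decoded:
  assumes "has_retract X Y \<phi> n"
  shows "has_retract (delayed_graph e n \<phi> ` X) Y decoded 0"
proof -
  have "\<exists>w \<in> delayed_graph e n \<phi> ` X. decoded w = y \<and> (\<forall>i\<le>0. w i = delayed_graph e n \<phi> x i)"
    if x: "x \<in> X" and y: "y \<in> Y" and agree: "\<forall>i\<le>0. \<phi> x i = y i" for x y
  proof -
    obtain z where z: "z \<in> X" "\<phi> z = y" "\<forall>i\<le>- int n. z i = x i"
      using assms x y agree unfolding has_retract_def by blast
    then have "\<forall>i\<le>0. delayed_graph e n \<phi> z i = delayed_graph e n \<phi> x i"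
      using agree by (auto intro!: delayed_graph_cong[where k = 0])
    then show ?thesis
      using z decoded_delayed_graph by blast
  qed
  then show ?thesis
    unfolding has_retract_def using decoded_delayed_graph by (auto simp del: o_apply)
qed

end

theorem theorem6p1:
  fixes A :: "'a set" and B :: "'b set"
    and X :: "(int \<Rightarrow> 'a) set" and Y :: "(int \<Rightarrow> 'b) set"
    and \<phi> :: "(int \<Rightarrow> 'a) \<Rightarrow> (int \<Rightarrow> 'b)"
  assumes "shift_space A X" and "shift_space B Y"
    and "right_continuing A X B Y \<phi>"
    and "\<exists>n. has_retract X Y \<phi> n"
  shows "\<exists>(C :: nat set) (Z :: (int \<Rightarrow> nat) set) (\<psi> :: (int \<Rightarrow> 'a) \<Rightarrow> (int \<Rightarrow> nat)).
           shift_space C Z \<and>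
           topological_conjugacy A X C Z \<psi> \<and>
           right_continuing C Z B Y (\<phi> \<circ> inv_into X \<psi>) \<and>
           one_block_code C Z B Y (\<phi> \<circ> inv_into X \<psi>) \<and>
           has_retract Z Y (\<phi> \<circ> inv_into X \<psi>) 0"
proof -
  obtain n where n: "has_retract X Y \<phi> n"
    using assms(4) by blast
  have "finite (A \<times> B)"
    using assms(1,2) by (simp add: shift_space_def)
  then obtain e :: "'a \<times> 'b \<Rightarrow> nat" where e: "inj_on e (A \<times> B)"
    using finite_imp_inj_to_nat_seg by metis
  have "block_code A X B Y \<phi>" "\<phi> ` X = Y"
    using assms(3) by (auto simp: right_continuing_def)
  note context_facts = assms(1,2) this e
  show ?thesis
    using shift_space_delayed_graph[OF context_facts]
      topological_conjugacy_delayed_graph[OF context_facts]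
      right_continuing_decoded[OF context_facts assms(3)]
      one_block_code_decoded[OF context_facts]
      has_retract_decoded[OF context_facts n]
    by blast
qed

end
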